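(* Let $1\le D\le d$ be integers. Then the CP graph $G(d,D)$ has a short spanning factorization.
   Context: The CP graph $G(d,D)$ is the directed graph whose vertices are the vectors $x=x_1x_2\dots x_D$ of length $D$ with distinct entries from $\{1,2,\dots,d+1\}$, and whose edges go from $x$ to each of the following $d$ out-neighbors: $$R_k(x_1x_2\dots x_D)=x_kx_1\dots x_{k-1}x_{k+1}\dots x_D\quad (2\le k\le D),$$ $$S_m(x_1x_2\dots x_D)=m\,x_1x_2\dots x_{D-1}\quad (m\in\{1,\dots,d+1\}\setminus\{x_1,\dots,x_D\}).$$ It has in-degree and out-degree $d$ and diameter $D$. A 1-factor of a directed graph $G$ is a (spanning) subgraph in which every vertex has in-degree and out-degree equal to 1. A 1-factoring of a directed graph with all in-degrees and out-degrees equal to $d$ is a decomposition of its edge set into $d$ edge-disjoint 1-factors $F_1,\dots,F_d$. A word is a finite string of symbols from $\{F_1,\dots,F_d\}$. If $v$ is a vertex and $\omega$ is a word, $v\omega$ denotes the directed path (and also its endpoint) starting at $v$ and following successively, for each consecutive symbol of $\omega$, the unique edge of that factor leaving the current vertex. If $G$ has $n$ vertices, a 1-factoring together with a set of $n$ words $W=\{\omega_0,\omega_1,\dots,\omega_{n-1}\}$ with $\omega_0=\emptyset$ is a spanning factorization of $G$ (with word list $W$) if for every vertex $v$ the vertices $v\omega_0,\dots,v\omega_{n-1}$ are distinct. Let $|\{F_i:F_i\in W\}|$ denote the total number of occurrences (with multiplicity) of the symbol $F_i$ in the words of $W$. Let $N_k$ be the number of ordered pairs $(u,w)$ of vertices such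 that the directed distance from $u$ to $w$ is $k$, and let $D$ be the diameter of $G$. A spanning factorization is short if $$\left\lceil \sum_{i=1}^{d} |\{F_i : F_i \in W\}| / d \right\rceil = \left\lceil \sum_{k=1}^{D} \frac{kN_k}{nd} \right\rceil .$$ *)

theory Defs
  imports "Graph_Theory.Graph_Theory"
begin

section \<open>Distances\<close>

text \<open>The directed distance is the shortest-path cost for unit weights; it is infinite
  if there is no walk.\<close>

definition distance :: "('a, 'b) pre_digraph \<Rightarrow> 'a \<Rightarrow> 'a \<Rightarrow> ereal" where
  "distance G u v = wf_digraph.\<mu> G (\<lambda>_. 1) u v"

lemma (in wf_digraph) distance_eq_iff:
  "distance G u w = ereal (real k) \<longleftrightarrow>
     (\<exists>p. awalk u p w \<and> length p = k) \<and> (\<forall>p. awalk u p w \<longrightarrow> k \<le> length p)" (is "?L = ?R")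
proof -
  have c: "awalk_cost (\<lambda>_. 1) p = real (length p)" for p :: "'b list" by (simp add: awalk_cost_def sum_list_triv)
  define A where "A = length ` {p. awalk u p w}"
  have d: "distance G u w = (INF n\<in>A. ereal (real n))"
    by (simp add: distance_def \<mu>_def c A_def image_image)
  have *: "(INF n\<in>A. ereal (real n)) = ereal (real m)" if "m \<in> A" "\<forall>n\<in>A. m \<le> n" for m
    using that by (intro INF_eqI) auto
  show ?thesis
  proof
    assume L: ?L
    then have "A \<noteq> {}" using d by (auto simp: top_ereal_def)
    define m where "m = (LEAST n. n \<in> A)"
    have m: "m \<in> A" "\<forall>n\<in>A. m \<le> n" using \<open>A \<noteq> {}\<close> unfolding m_def by (auto intro: LeastI Least_le)
    with * L d have "m = k" by auto
    with m show ?R unfolding A_def by auto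
  next
    assume ?R then show ?L using *[of k] d unfolding A_def by auto
  qed
qed

definition diameter :: "('a, 'b) pre_digraph \<Rightarrow> ereal" where
  "diameter G = (SUP u\<in>verts G. SUP v\<in>verts G. distance G u v)"

definition num_pairs_at_distance :: "('a, 'b) pre_digraph \<Rightarrow> nat \<Rightarrow> nat" where
  "num_pairs_at_distance G k =
     card {(u, w). u \<in> verts G \<and> w \<in> verts G \<and> distance G u w = ereal (real k)}"


section \<open>Spanning factorizations\<close>

definition one_factor :: "('a, 'b) pre_digraph \<Rightarrow> ('a, 'b) pre_digraph \<Rightarrow> bool" where
  "one_factor H G \<longleftrightarrow> spanning H G \<and> (\<forall>v\<in>verts H. in_degree H v = 1 \<and> out_degree H v = 1)"

definition regular_digraph :: "('a, 'b) pre_digraph \<Rightarrow> nat \<Rightarrow> bool" where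
  "regular_digraph G d \<longleftrightarrow> (\<forall>v\<in>verts G. in_degree G v = d \<and> out_degree G v = d)"

definition one_factoring ::
    "('a, 'b) pre_digraph \<Rightarrow> nat \<Rightarrow> (nat \<Rightarrow> ('a, 'b) pre_digraph) \<Rightarrow> bool" where
  "one_factoring G d F \<longleftrightarrow>
     regular_digraph G d \<and>
     (\<forall>i\<in>{1..d}. one_factor (F i) G) \<and>
     (\<forall>i\<in>{1..d}. \<forall>j\<in>{1..d}. i \<noteq> j \<longrightarrow> arcs (F i) \<inter> arcs (F j) = {}) \<and>
     (\<Union>i\<in>{1..d}. arcs (F i)) = arcs G"

text \<open>The symbol \<open>F i\<close> of a word is represented by its index \<open>i\<close>.\<close>

type_synonym factor_word = "nat list"

text \<open>Only used for a 1-factor \<open>H\<close>, where the outgoing arc of \<open>v\<close> is unique.\<close>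

definition next_vertex :: "('a, 'b) pre_digraph \<Rightarrow> 'a \<Rightarrow> 'a" where
  "next_vertex H v = head H (THE e. e \<in> out_arcs H v)"

primrec word_end :: "(nat \<Rightarrow> ('a, 'b) pre_digraph) \<Rightarrow> 'a \<Rightarrow> factor_word \<Rightarrow> 'a" where
  "word_end F v [] = v"
| "word_end F v (i # \<omega>) = word_end F (next_vertex (F i) v) \<omega>"

definition spanning_factorization ::
    "('a, 'b) pre_digraph \<Rightarrow> nat \<Rightarrow> (nat \<Rightarrow> ('a, 'b) pre_digraph) \<Rightarrow> factor_word list \<Rightarrow> bool"
  where
  "spanning_factorization G d F W \<longleftrightarrow>
     one_factoring G d F \<and>
     length W = card (verts G) \<and>
     (\<forall>\<omega>\<in>set W. set \<omega> \<subseteq> {1..d}) \<and>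
     W ! 0 = [] \<and>
     (\<forall>v\<in>verts G. distinct (map (word_end F v) W))"

definition occurrences :: "factor_word list \<Rightarrow> nat \<Rightarrow> nat" where
  "occurrences W i = (\<Sum>\<omega>\<leftarrow>W. count_list \<omega> i)"

text \<open>If the diameter is infinite, the index set on the right is infinite and the sum is 0 by
  convention; this never happens for a spanning factorization of a finite digraph, which forces
  strong connectivity.\<close>

definition short_spanning_factorization ::
    "('a, 'b) pre_digraph \<Rightarrow> nat \<Rightarrow> (nat \<Rightarrow> ('a, 'b) pre_digraph) \<Rightarrow> factor_word list \<Rightarrow> bool"
  where
  "short_spanning_factorization G d F W \<longleftrightarrow>
     spanning_factorization G d F W \<and>
     \<lceil>(\<Sum>i=1..d. real (occurrences W i)) / real d\<rceil> =
     \<lceil>\<Sum>k | 1 \<le> k \<and> ereal (real k) \<le> diameter G.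
        real (k * num_pairs_at_distance G k) / real (card (verts G) * d)\<rceil>"


section \<open>CP graphs\<close>

text \<open>Positions are counted from 1, so \<open>x\<^sub>k\<close> is \<open>x ! (k - 1)\<close>.\<close>

definition R_step :: "nat \<Rightarrow> nat list \<Rightarrow> nat list" where
  "R_step k x = x ! (k - 1) # take (k - 1) x @ drop k x"

definition S_step :: "nat \<Rightarrow> nat list \<Rightarrow> nat list" where
  "S_step m x = m # butlast x"

definition CP_verts :: "nat \<Rightarrow> nat \<Rightarrow> nat list set" where
  "CP_verts d D = {x. length x = D \<and> distinct x \<and> set x \<subseteq> {1..d + 1}}"

definition CP_graph :: "nat \<Rightarrow> nat \<Rightarrow> nat list pair_pre_digraph" where
  "CP_graph d D =
     \<lparr> pverts = CP_verts d D,
       parcs = {(x, R_step k x) | x k. x \<in> CP_verts d D \<and> k \<in> {2..D}} \<union>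
               {(x, S_step m x) | x m. x \<in> CP_verts d D \<and> m \<in> {1..d + 1} - set x} \<rparr>"

lemma R_step_in_CP_verts: assumes "x \<in> CP_verts d D" "k \<in> {2..D}" shows "R_step k x \<in> CP_verts d D"
proof -
  have k: "k - 1 < length x" "Suc (k - 1) = k" using assms by (auto simp: CP_verts_def)
  have "x = take (k-1) x @ x!(k-1) # drop k x" using id_take_nth_drop[OF k(1)] k(2) by simp
  then have "mset x = mset (R_step k x)"
    unfolding R_step_def by (metis (no_types, lifting) mset.simps(2) mset_append union_mset_add_mset_right)
  then have "length (R_step k x) = length x" "distinct (R_step k x) = distinct x" "set (R_step k x) = set x"
    by (metis mset_eq_length) (metis \<open>mset x = mset (R_step k x)\<close> mset_eq_imp_distinct_iff, metis \<open>mset x = mset (R_step k x)\<close> mset_eq_setD)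
  then show ?thesis using assms by (simp add: CP_verts_def)
qed

lemma S_step_in_CP_verts: assumes "x \<in> CP_verts d D" "1 \<le> D" "m \<in> {1..d+1} - set x" shows "S_step m x \<in> CP_verts d D"
  using assms by (auto simp: CP_verts_def S_step_def distinct_butlast dest: in_set_butlastD)

lemma pair_wf_digraph_CP_graph: "1 \<le> D \<Longrightarrow> pair_wf_digraph (CP_graph d D)"
  using R_step_in_CP_verts S_step_in_CP_verts
  by unfold_locales (auto simp: CP_graph_def)

end

theory Submission
  imports Defs
begin

text \<open>An edge of the CP graph brings a symbol other than the first to the front; everything else
  keeps its order, and the last symbol drops off if the new one was not in the list. A walk from
  \<open>x\<close> is therefore determined by the sequence of symbols it touches, and its end consists of the touched
  symbols, most recent first, followed by the untouched symbols of \<open>x\<close> in their old order, cut to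
  length \<open>D\<close> (\<open>fold_touch\<close>). Two facts about distances follow. A geodesic of length \<open>k\<close> to \<open>w\<close>
  touches \<open>w\<^sub>k, \<dots>, w\<^sub>1\<close> in this order, so geodesics are unique. And a sequence of at most \<open>D\<close>
  distinct symbols \<open>s\<^sub>1, \<dots>, s\<^sub>k\<close> is a geodesic unless every symbol in front of \<open>s\<^sub>1\<close> in \<open>x\<close> is
  touched later: only then does \<open>s\<^sub>1\<close>, if left alone, end up in the same place
  (\<open>geodesic_symbols_minimal\<close>, \<open>geodesic_symbols_exist\<close>).

  The edges \<open>R\<^sub>k\<close> form a 1-factor for each \<open>k\<close>. For a fixed list \<open>u\<close> of length \<open>D - 1\<close> with
  complement \<open>C\<close>, the edges \<open>S\<^sub>m\<close> lead from the lists \<open>u z\<close> to the lists \<open>m u\<close> with distinct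
  \<open>z, m \<in> C\<close>; these blocks are complete bipartite graphs without a perfect matching, and the
  nontrivial cyclic shifts of \<open>C\<close> split all of them at once into \<open>d + 1 - D\<close> factors.

  The word list consists of the words that label geodesics, and the point is that this property of
  a word does not depend on the starting vertex (\<open>geodesic_words_iff\<close>). After some steps the touched
  symbols fill the first places of the list, and right behind them stand the untouched symbols that
  were in front of \<open>s\<^sub>1\<close>. So a label tells by its position alone whether it touches a new symbol and
  whether that symbol was in front of \<open>s\<^sub>1\<close>, at least as long as enough steps remain to touch all
  the symbols that were in front of \<open>s\<^sub>1\<close>. Uniqueness of
  geodesics makes the word list a bijection onto the vertices from every start
  (\<open>bij_betw_geodesic_words\<close>), and the length of a word is the distance it covers, so the two
  sums in the definition of shortness agree even before rounding.\<close>

section \<open>Touching symbols\<close>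

text \<open>For a list of length \<open>D\<close> this is both kinds of step at once: if \<open>s\<close> occurs in the list nothing is
  cut off, otherwise the last symbol is.\<close>

definition touch :: "'a \<Rightarrow> 'a list \<Rightarrow> 'a list" where
  "touch s x = take (length x) (s # removeAll s x)"

lemma length_removeAll_ge: "distinct xs \<Longrightarrow> length xs \<le> Suc (length (removeAll s xs))"
  by (cases xs) (auto simp: distinct_remove1_removeAll[symmetric] length_remove1)

lemma length_touch [simp]: "distinct x \<Longrightarrow> length (touch s x) = length x"
  using length_removeAll_ge[of x s] by (simp add: touch_def)

lemma distinct_touch [simp]: "distinct x \<Longrightarrow> distinct (touch s x)"
  by (simp add: touch_def distinct_removeAll)

text \<open>Cutting can be postponed to the end, since a symbol that is touched while it lies beyond the cut
  pushes the last visible symbol out exactly as a new symbol does.\<close>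

lemma touch_take:
  assumes "distinct L" "n \<le> length L"
  shows "touch s (take n L) = take n (s # removeAll s L)"
proof (cases n)
  case 0 then show ?thesis by (simp add: touch_def)
next
  case (Suc m)
  have "length (take n L) \<le> Suc (length (removeAll s (take n L)))"
    using assms by (intro length_removeAll_ge) simp
  then have m: "m \<le> length (removeAll s (take n L))" using Suc assms by simp
  have "removeAll s L = removeAll s (take n L) @ removeAll s (drop n L)"
    by (metis append_take_drop_id removeAll_append)
  then have "take m (removeAll s L) = take m (removeAll s (take n L))" using m by simp
  then show ?thesis using Suc assms by (simp add: touch_def)
qed

lemma remdups_snoc: "remdups (xs @ [s]) = removeAll s (remdups xs) @ [s]"
  by (induction xs) auto

lemma fold_touch:
  assumes "distinct x"
  shows "fold touch ss x = take (length x) (rev (remdups ss) @ filter (\<lambda>a. a \<notin> set ss) x)"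
proof (induction ss rule: rev_induct)
  case Nil then show ?case by simp
next
  case (snoc s ss)
  let ?L = "rev (remdups ss) @ filter (\<lambda>a. a \<notin> set ss) x"
  have d: "distinct ?L" using assms by auto
  have "card (set x) \<le> card (set ?L)" by (intro card_mono) auto
  then have "length x \<le> length ?L" using d assms by (metis distinct_card)
  moreover have "removeAll s ?L = rev (removeAll s (remdups ss)) @ filter (\<lambda>a. a \<notin> set (ss @ [s])) x"
    by (auto simp: removeAll_filter_not_eq rev_filter intro!: filter_cong)
  ultimately show ?case using snoc touch_take[OF d] by (simp add: remdups_snoc)
qed

text \<open>The second condition fails when all symbols in front of \<open>s\<close> are touched later. In that case the
  touch of \<open>s\<close> is superfluous, because \<open>s\<close> is then the first untouched symbol anyway.\<close>

definition geodesic_symbols :: "'a list \<Rightarrow> 'a list \<Rightarrow> bool" where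
  "geodesic_symbols x ss \<longleftrightarrow> distinct ss \<and>
     (\<forall>s ts. ss = s # ts \<longrightarrow> \<not> set (takeWhile (\<lambda>a. a \<noteq> s) x) \<subseteq> set ts)"

lemma geodesic_symbols_distinct: "geodesic_symbols x ss \<Longrightarrow> distinct ss"
  unfolding geodesic_symbols_def by (rule conjunct1)

lemma take_fold_touch:
  assumes "distinct x" "distinct ss" "length ss \<le> length x"
  shows "take (length ss) (fold touch ss x) = rev ss"
  using assms by (simp add: fold_touch distinct_remdups_id)

lemma takeWhile_filter_neq:
  "Q s \<Longrightarrow> takeWhile (\<lambda>a. a \<noteq> s) (filter Q x) = filter Q (takeWhile (\<lambda>a. a \<noteq> s) x)"
  by (induction x) auto

text \<open>The touched symbols appear, reversed, as a prefix of the end point. A shorter sequence with the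
  same end would account for a proper part of this prefix only; the rest of the prefix, which ends in
  the first touched symbol \<open>s\<close>, would consist of symbols that it leaves untouched and in their old
  order. Then no other symbol can have stood in front of \<open>s\<close>.\<close>

lemma geodesic_symbols_minimal:
  assumes x: "distinct x" and geo: "geodesic_symbols x ss" and len: "length ss \<le> length x"
    and eq: "fold touch ss x = fold touch ts x"
  shows "length ss \<le> length ts"
proof (rule ccontr)
  assume less: "\<not> length ss \<le> length ts"
  define us where "us = remdups ts"
  have us: "length us < length ss"
    using less length_remdups_leq[of ts] unfolding us_def by linarith
  then obtain s ss' where ss: "ss = s # ss'" by (cases ss) auto
  have d: "distinct ss" using geo by (simp add: geodesic_symbols_def)
  let ?w = "fold touch ss x" and ?f = "filter (\<lambda>a. a \<notin> set ts) x" and ?j = "length us"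
  have w1: "take (length ss) ?w = rev ss" using x d len by (rule take_fold_touch)
  have "?w = take (length x) (rev us @ ?f)" using eq fold_touch[OF x] us_def by metis
  then have w2: "take (length ss) ?w = rev us @ take (length ss - ?j) ?f"
    using us len by (simp add: min_absorb1)
  have split: "rev ss' @ [s] = rev us @ take (length ss - ?j) ?f"
    using w1 w2 ss by simp
  have j: "?j \<le> length ss'" using us ss by simp
  have a: "rev us = take ?j (rev ss')"
    using arg_cong[OF split, of "take ?j"] j by simp
  have b: "take (length ss - ?j) ?f = drop ?j (rev ss') @ [s]"
    using arg_cong[OF split, of "drop ?j"] j by simp
  define r where "r = drop (length ss - ?j) ?f"
  have "?f = take (length ss - ?j) ?f @ r" by (simp add: r_def)
  also have "\<dots> = drop ?j (rev ss') @ s # r" by (simp only: b append.assoc append_Cons append_Nil)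
  finally have f: "?f = drop ?j (rev ss') @ s # r" .
  have "s \<in> set ?f" unfolding f by simp
  then have s: "s \<notin> set ts" by simp
  have "s \<notin> set (drop ?j (rev ss'))" using d ss by (auto dest: in_set_dropD)
  then have "takeWhile (\<lambda>a. a \<noteq> s) ?f = drop ?j (rev ss')"
    unfolding f by (subst takeWhile_append2) auto
  then have c: "filter (\<lambda>a. a \<notin> set ts) (takeWhile (\<lambda>a. a \<noteq> s) x) = drop ?j (rev ss')"
    using s by (simp add: takeWhile_filter_neq)
  have "set (takeWhile (\<lambda>a. a \<noteq> s) x) \<subseteq> set ss'"
  proof
    fix a assume h: "a \<in> set (takeWhile (\<lambda>a. a \<noteq> s) x)"
    show "a \<in> set ss'"
    proof (cases "a \<in> set ts")
      case True
      then have "a \<in> set (rev us)" by (simp add: us_def)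
      then have "a \<in> set (rev ss')" unfolding a by (rule in_set_takeD)
      then show ?thesis by simp
    next
      case False
      then have "a \<in> set (drop ?j (rev ss'))" using h unfolding c[symmetric] by simp
      then have "a \<in> set (rev ss')" by (rule in_set_dropD)
      then show ?thesis by simp
    qed
  qed
  then show False using geo ss by (auto simp: geodesic_symbols_def)
qed

lemma geodesic_symbols_unique:
  assumes "distinct x" "geodesic_symbols x ss" "length ss \<le> length x"
    "geodesic_symbols x ts" "length ts \<le> length x" "fold touch ss x = fold touch ts x"
  shows "ss = ts"
proof -
  have len: "length ss = length ts"
    using geodesic_symbols_minimal[OF assms(1,2,3,6)]
      geodesic_symbols_minimal[OF assms(1,4,5) assms(6)[symmetric]] by (rule le_antisym)
  have d: "distinct ss" "distinct ts" by (fact assms(2,4)[THEN geodesic_symbols_distinct])+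
  have "rev ss = take (length ss) (fold touch ss x)"
    by (rule take_fold_touch[symmetric]) (fact assms d)+
  also have "\<dots> = take (length ts) (fold touch ts x)" by (simp only: len assms(6))
  also have "\<dots> = rev ts" by (rule take_fold_touch) (fact assms d)+
  finally show ?thesis by simp
qed

lemma filter_hd_takeWhile:
  assumes "distinct x" "s \<in> set x" "s \<notin> set ts" "set (takeWhile (\<lambda>a. a \<noteq> s) x) \<subseteq> set ts"
  shows "filter (\<lambda>a. a \<notin> set ts) x = s # filter (\<lambda>a. a \<notin> set (s # ts)) x"
  using assms
proof (induction x)
  case (Cons a x)
  show ?case
  proof (cases "a = s")
    case True
    have "filter (\<lambda>a. a \<notin> set ts) x = filter (\<lambda>a. a \<notin> set (s # ts)) x"
      using Cons.prems(1) True by (intro filter_cong) auto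
    then show ?thesis using True Cons.prems(3) by simp
  next
    case False
    then have "a \<in> set ts" using Cons.prems(4) by simp
    then show ?thesis using False Cons.IH Cons.prems by simp
  qed
qed simp

text \<open>Touching the symbols of \<open>w\<close> from last to first leads to \<open>w\<close>, so a shortest sequence exists and has
  at most \<open>length x\<close> symbols. Repeated symbols, or a superfluous first one, could be left out.\<close>

lemma geodesic_symbols_exist:
  assumes x: "distinct x" and w: "distinct w" "length w = length x"
  obtains ss where "geodesic_symbols x ss" "length ss \<le> length x" "set ss \<subseteq> set w" "fold touch ss x = w"
proof -
  let ?P = "\<lambda>ss. fold touch ss x = w"
  define ss where "ss = arg_min length ?P"
  have P0: "?P (rev w)" using w x by (simp add: fold_touch distinct_remdups_id)
  have P: "?P ss" and min: "?P ts \<Longrightarrow> length ss \<le> length ts" for ts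
    using arg_min_nat_lemma[of ?P, OF P0, of length] by (auto simp: ss_def)
  have len: "length ss \<le> length x" using min[OF P0] w by simp
  have "?P (remdups ss)" using P x by (simp add: fold_touch distinct_remdups_id)
  from min[OF this] have "length (remdups ss) = length ss" using length_remdups_leq[of ss] by simp
  then have d: "distinct ss" by (metis length_remdups_eq distinct_remdups)
  have "geodesic_symbols x ss"
    unfolding geodesic_symbols_def
  proof (intro conjI allI impI notI)
    show "distinct ss" by (fact d)
  next
    fix s ts assume ss: "ss = s # ts" and sub: "set (takeWhile (\<lambda>a. a \<noteq> s) x) \<subseteq> set ts"
    \<comment> \<open>If \<open>s\<close> were a new symbol, all of \<open>x\<close> would have to be touched, by fewer than \<open>length x\<close> touches.\<close>
    have s: "s \<in> set x"
    proof (rule ccontr)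
      assume "s \<notin> set x"
      then have "takeWhile (\<lambda>a. a \<noteq> s) x = x" by (auto simp: takeWhile_eq_all_conv)
      then have "set x \<subseteq> set ts" using sub by argo
      then have "card (set x) \<le> card (set ts)" by (simp add: card_mono)
      then show False using len ss x card_length[of ts] by (simp add: distinct_card)
    qed
    have "filter (\<lambda>a. a \<notin> set ts) x = s # filter (\<lambda>a. a \<notin> set ss) x"
      using filter_hd_takeWhile[OF x s _ sub] d ss by simp
    then have "fold touch ts x = fold touch ss x"
      using d ss len unfolding fold_touch[OF x] by (simp add: distinct_remdups_id Suc_diff_le)
    then have "?P ts" using P by simp
    from min[OF this] show False using ss by simp
  qed
  moreover have "rev ss = take (length ss) w" using take_fold_touch[OF x d len] P by simp
  then have "set ss \<subseteq> set w" by (metis set_rev set_take_subset)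
  ultimately show thesis using that len P by blast
qed

section \<open>Cyclic shifts of a finite set\<close>

definition cyclic_shift :: "'a set \<Rightarrow> nat \<Rightarrow> 'a \<Rightarrow> 'a" where
  "cyclic_shift C a z =
     (let e = (SOME e. bij_betw e {0..<card C} C)
      in e ((inv_into {0..<card C} e z + a) mod card C))"

lemma inj_on_mod_add: "inj_on (\<lambda>a. (b + a) mod n) {0..<n::nat}"
proof (rule linorder_inj_onI')
  fix a c assume *: "a \<in> {0..<n}" "c \<in> {0..<n}" "a < c"
  show "(b + a) mod n \<noteq> (b + c) mod n"
  proof
    assume "(b + a) mod n = (b + c) mod n"
    then have "n dvd c - a" using * by (subst (asm) eq_commute) (simp add: mod_eq_dvd_iff_nat)
    then show False using * by (auto dest: dvd_imp_le)
  qed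
qed

text \<open>The shifts of a finite set form a Latin square: distinct amounts move a given element to distinct
  places, and each shift is a permutation. They split the complete bipartite graph on two copies of
  the set into perfect matchings, the shift by 0 being the identity matching.\<close>

lemma
  assumes "finite C"
  shows cyclic_shift_0: "z \<in> C \<Longrightarrow> cyclic_shift C 0 z = z"
    and cyclic_shift_amount: "z \<in> C \<Longrightarrow> (\<lambda>a. cyclic_shift C a z) ` {0..<card C} = C"
    and inj_on_cyclic_shift: "inj_on (cyclic_shift C a) C"
proof -
  let ?n = "card C"
  define e where "e = (SOME e. bij_betw e {0..<?n} C)"
  have e: "bij_betw e {0..<?n} C"
    unfolding e_def using ex_bij_betw_nat_finite[OF assms] by (rule someI_ex)
  let ?i = "inv_into {0..<?n} e"
  have i: "bij_betw ?i C {0..<?n}" using e by (rule bij_betw_inv_into)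
  have sh: "cyclic_shift C a z = e ((?i z + a) mod ?n)" for a z
    by (simp add: cyclic_shift_def e_def Let_def)
  have im: "(\<lambda>a. (b + a) mod ?n) ` {0..<?n} = {0..<?n}" for b
    by (rule endo_inj_surj) (auto simp: inj_on_mod_add)
  { assume "z \<in> C"
    then have "?i z < ?n" using i by (auto dest: bij_betwE)
    then show "cyclic_shift C 0 z = z" using \<open>z \<in> C\<close> e sh by (simp add: bij_betw_inv_into_right) }
  have "(\<lambda>a. cyclic_shift C a z) ` {0..<card C} = e ` (\<lambda>a. (?i z + a) mod ?n) ` {0..<?n}"
    by (simp add: sh image_image)
  also have "\<dots> = C" using e im by (simp add: bij_betw_def)
  finally show "(\<lambda>a. cyclic_shift C a z) ` {0..<card C} = C" .
  have "inj_on (\<lambda>b. (a + b) mod ?n) {0..<?n}" by (rule inj_on_mod_add)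
  then have "inj_on (\<lambda>b. (b + a) mod ?n) {0..<?n}" by (simp add: add.commute)
  moreover have "(\<lambda>b. (b + a) mod ?n) ` {0..<?n} \<subseteq> {0..<?n}" by auto
  ultimately have "inj_on (\<lambda>b. e ((b + a) mod ?n)) (?i ` C)"
    using i e comp_inj_on[of "\<lambda>b. (b + a) mod ?n" "{0..<?n}" e]
    by (auto simp: bij_betw_def o_def intro: inj_on_subset)
  then show "inj_on (cyclic_shift C a) C"
    using i comp_inj_on[of ?i C "\<lambda>b. e ((b + a) mod ?n)"]
    by (simp add: bij_betw_def o_def sh[abs_def])
qed

section \<open>The 1-factors of a CP graph\<close>

locale cp_graph =
  fixes d D :: nat
  assumes D_pos: "1 \<le> D" and D_le: "D \<le> d"
begin

abbreviation "V \<equiv> CP_verts d D"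

text \<open>Positions are counted from 0 here, so for \<open>0 < i < D\<close> the label \<open>i\<close> stands for \<open>R\<^bsub>i+1\<^esub>\<close>. The labels
  \<open>D, \<dots>, d\<close> stand for edges \<open>S\<^sub>m\<close>, where \<open>m\<close> is a shift of the dropped symbol by an amount from
  \<open>1\<close> to \<open>d + 1 - D\<close>; they play the part of positions behind the end of the list. Label 0 touches
  the first symbol. It is not an edge, but makes the labels at \<open>x\<close> correspond to all symbols.\<close>

definition move_symbol :: "nat \<Rightarrow> nat list \<Rightarrow> nat" where
  "move_symbol i x =
     (if i < D then x ! i
      else cyclic_shift ({1..d + 1} - set (butlast x)) (i + 1 - D) (last x))"

definition move :: "nat \<Rightarrow> nat list \<Rightarrow> nat list" where
  "move i x = touch (move_symbol i x) x"

lemma CP_vertsD: "x \<in> V \<Longrightarrow> length x = D" "x \<in> V \<Longrightarrow> distinct x" "x \<in> V \<Longrightarrow> set x \<subseteq> {1..d + 1}"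
  "x \<in> V \<Longrightarrow> x \<noteq> []"
  using D_pos by (auto simp: CP_verts_def)

lemma complement_butlast:
  assumes "x \<in> V"
  shows "card ({1..d + 1} - set (butlast x)) = d + 2 - D"
    and "last x \<in> {1..d + 1} - set (butlast x)"
proof -
  have "card (set (butlast x)) = D - 1"
    using CP_vertsD[OF assms] by (simp add: distinct_card distinct_butlast)
  moreover have "set (butlast x) \<subseteq> {1..d + 1}"
    using CP_vertsD[OF assms] by (auto dest: in_set_butlastD)
  ultimately show "card ({1..d + 1} - set (butlast x)) = d + 2 - D"
    using D_pos by (subst card_Diff_subset) auto
  have "distinct (butlast x @ [last x])" using CP_vertsD[OF assms] by simp
  moreover have "last x \<in> {1..d + 1}" using CP_vertsD[OF assms] last_in_set by blast
  ultimately show "last x \<in> {1..d + 1} - set (butlast x)"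
    by simp
qed

text \<open>The labels below \<open>D - 1\<close> give the symbols of \<open>butlast x\<close>. The others give its complement: label
  \<open>D - 1\<close> is the last symbol itself, which is its own shift by 0.\<close>

lemma move_symbol_image:
  assumes x: "x \<in> V"
  shows "(\<lambda>i. move_symbol i x) ` {..d} = {1..d + 1}"
proof -
  let ?C = "{1..d + 1} - set (butlast x)"
  have low: "move_symbol i x = butlast x ! i" if "i < D - 1" for i
  proof -
    have "i < D" using that by simp
    then show ?thesis using that CP_vertsD(1)[OF x] by (simp add: move_symbol_def nth_butlast)
  qed
  have low_image: "(\<lambda>i. move_symbol i x) ` {..<D - 1} = (\<lambda>i. butlast x ! i) ` {..<D - 1}"
    by (rule image_cong) (simp_all add: low)
  have high: "move_symbol (D - 1 + a) x = cyclic_shift ?C a (last x)" for a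
    using CP_vertsD[OF x] D_pos complement_butlast[OF x]
    by (cases a) (auto simp: move_symbol_def cyclic_shift_0 last_conv_nth)
  have "{..d} = {..<D - 1} \<union> (\<lambda>a. D - 1 + a) ` {0..<d + 2 - D}"
    using D_pos D_le by (auto simp: image_iff Bex_def) presburger
  then have "(\<lambda>i. move_symbol i x) ` {..d} =
      (\<lambda>i. butlast x ! i) ` {..<D - 1} \<union> (\<lambda>a. cyclic_shift ?C a (last x)) ` {0..<d + 2 - D}"
    by (simp only: image_Un image_image high low_image)
  also have "(\<lambda>i. butlast x ! i) ` {..<D - 1} = set (butlast x)"
    using CP_vertsD[OF x] by (auto simp: set_conv_nth)
  also have "(\<lambda>a. cyclic_shift ?C a (last x)) ` {0..<d + 2 - D} = ?C"
    using cyclic_shift_amount[of ?C "last x"] complement_butlast[OF x] by simp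
  also have "set (butlast x) \<union> ?C = {1..d + 1}"
    using CP_vertsD[OF x] by (auto dest: in_set_butlastD)
  finally show ?thesis .
qed

lemma inj_on_move_symbol:
  assumes "x \<in> V" shows "inj_on (\<lambda>i. move_symbol i x) {..d}"
  by (rule eq_card_imp_inj_on) (simp_all add: move_symbol_image[OF assms])

lemma move_symbol_eq_iff:
  "x \<in> V \<Longrightarrow> i \<le> d \<Longrightarrow> j \<le> d \<Longrightarrow> move_symbol i x = move_symbol j x \<longleftrightarrow> i = j"
  using inj_on_move_symbol[of x] by (auto simp: inj_on_def)

lemma move_symbol_less: "i < D \<Longrightarrow> move_symbol i x = x ! i"
  by (simp add: move_symbol_def)

lemma move_symbol_notin:
  assumes "x \<in> V" "D \<le> i" "i \<le> d" shows "move_symbol i x \<notin> set x"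
proof
  assume "move_symbol i x \<in> set x"
  then obtain j where "j < D" "move_symbol i x = move_symbol j x"
    using CP_vertsD[OF assms(1)] by (auto simp: in_set_conv_nth move_symbol_less)
  then show False using move_symbol_eq_iff[of x i j] assms D_le by auto
qed

lemma move_less:
  assumes "x \<in> V" "i < D"
  shows "move i x = R_step (Suc i) x"
proof -
  have x: "take i x @ x ! i # drop (Suc i) x = x"
    using assms CP_vertsD by (intro id_take_nth_drop[symmetric]) simp
  then have "distinct (take i x @ x ! i # drop (Suc i) x)" using assms CP_vertsD by simp
  then have "removeAll (x ! i) (take i x @ x ! i # drop (Suc i) x) = take i x @ drop (Suc i) x"
    by simp
  then have "removeAll (x ! i) x = take i x @ drop (Suc i) x" by (simp only: x)
  then show ?thesis
    using assms CP_vertsD(1)[OF assms(1)] by (simp add: move_def move_symbol_less touch_def R_step_def)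
qed

lemma move_ge:
  assumes "x \<in> V" "D \<le> i" "i \<le> d"
  shows "move i x = S_step (move_symbol i x) x"
proof -
  have "removeAll (move_symbol i x) x = x" using move_symbol_notin[OF assms] by simp
  moreover have "take D (m # x) = m # butlast x" for m
    using CP_vertsD(1)[OF assms(1)] D_pos by (cases D) (simp_all add: butlast_conv_take)
  ultimately show ?thesis using CP_vertsD(1)[OF assms(1)] by (simp add: move_def touch_def S_step_def)
qed

lemma move_symbol_range: "x \<in> V \<Longrightarrow> i \<le> d \<Longrightarrow> move_symbol i x \<in> {1..d + 1}"
  using move_symbol_image[of x] by blast

lemma move_in_V:
  assumes "x \<in> V" "i \<le> d" shows "move i x \<in> V"
proof -
  have "set (move i x) \<subseteq> insert (move_symbol i x) (set x)"
    by (auto simp: move_def touch_def dest: in_set_takeD)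
  then show ?thesis using CP_vertsD[OF assms(1)] move_symbol_range[OF assms]
    by (auto simp: CP_verts_def move_def)
qed

lemma finite_V: "finite V"
proof -
  have "V \<subseteq> {x. set x \<subseteq> {1..d + 1} \<and> length x = D}" by (auto simp: CP_verts_def)
  then show ?thesis by (rule finite_subset) (simp add: finite_lists_length_eq)
qed

text \<open>For labels from \<open>D\<close> on, the end of an edge reveals \<open>butlast x\<close> and hence the shifted set; the
  dropped symbol is recovered since the shift is a permutation.\<close>

lemma inj_on_move:
  assumes i: "i \<le> d" shows "inj_on (move i) V"
proof (rule inj_onI)
  fix x y assume x: "x \<in> V" and y: "y \<in> V" and eq: "move i x = move i y"
  show "x = y"
  proof (cases "i < D")
    case True
    then have "x ! i = y ! i" "take i x @ drop (Suc i) x = take i y @ drop (Suc i) y"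
      using eq by (simp_all add: move_less x y R_step_def)
    moreover from this(2) have "take i x = take i y \<and> drop (Suc i) x = drop (Suc i) y"
      using CP_vertsD(1)[OF x] CP_vertsD(1)[OF y] by (subst (asm) append_eq_append_conv) simp_all
    ultimately show ?thesis
      using True CP_vertsD(1)[OF x] CP_vertsD(1)[OF y] id_take_nth_drop[of i x] id_take_nth_drop[of i y] by simp
  next
    case False
    then have b: "butlast x = butlast y" and s: "move_symbol i x = move_symbol i y"
      using eq i by (simp_all add: move_ge x y S_step_def)
    let ?C = "{1..d + 1} - set (butlast y)"
    have "cyclic_shift ?C (i + 1 - D) (last x) = cyclic_shift ?C (i + 1 - D) (last y)"
      using s False by (simp add: move_symbol_def b)
    moreover have "inj_on (cyclic_shift ?C (i + 1 - D)) ?C" by (rule inj_on_cyclic_shift) simp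
    ultimately have "last x = last y"
      using complement_butlast(2)[OF x] complement_butlast(2)[OF y] unfolding b by (meson inj_onD)
    then show ?thesis using b append_butlast_last_id CP_vertsD(4)[OF x] CP_vertsD(4)[OF y] by metis
  qed
qed

lemma bij_betw_move: "i \<le> d \<Longrightarrow> bij_betw (move i) V V"
  using inj_on_move[of i] move_in_V[of _ i] endo_inj_surj[OF finite_V, of "move i"]
  by (auto simp: bij_betw_def)

lemma parcs_CP_graph:
  "parcs (CP_graph d D) = (\<lambda>(x, i). (x, move i x)) ` (V \<times> {1..d})" (is "_ = ?M")
proof (intro equalityI subsetI)
  fix e assume "e \<in> parcs (CP_graph d D)"
  then consider (R) x k where "x \<in> V" "k \<in> {2..D}" "e = (x, R_step k x)"
    | (S) x m where "x \<in> V" "m \<in> {1..d + 1} - set x" "e = (x, S_step m x)"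
    by (auto simp: CP_graph_def)
  then show "e \<in> ?M"
  proof cases
    case R
    then have "e = (x, move (k - 1) x)" using move_less[of x "k - 1"] by auto
    then show ?thesis using R D_le by (intro image_eqI[of _ _ "(x, k - 1)"]) auto
  next
    case S
    then obtain i where i: "i \<le> d" "m = move_symbol i x" using move_symbol_image[of x] by (auto simp: image_iff set_eq_iff)
    have "D \<le> i" using S i CP_vertsD(1)[of x] by (auto simp: move_symbol_def split: if_splits)
    then have "e = (x, move i x)" using S i by (simp add: move_ge)
    then show ?thesis using S i D_pos \<open>D \<le> i\<close> by (intro image_eqI[of _ _ "(x, i)"]) auto
  qed
next
  fix e assume "e \<in> ?M"
  then obtain x i where e: "x \<in> V" "1 \<le> i" "i \<le> d" "e = (x, move i x)" by auto
  show "e \<in> parcs (CP_graph d D)"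
  proof (cases "i < D")
    case True
    then have "e = (x, R_step (Suc i) x)" "Suc i \<in> {2..D}" using e by (auto simp: move_less)
    then show ?thesis using e by (auto simp: CP_graph_def)
  next
    case False
    then show ?thesis using e move_symbol_range[of x i] move_symbol_notin[of x i]
      by (auto simp: CP_graph_def move_ge)
  qed
qed

lemma hd_touch: "x \<noteq> [] \<Longrightarrow> hd (touch s x) = s"
  by (cases x) (simp_all add: touch_def)

definition factor :: "nat \<Rightarrow> (nat list, nat list \<times> nat list) pre_digraph" where
  "factor i = with_proj \<lparr>pverts = V, parcs = (\<lambda>x. (x, move i x)) ` V\<rparr>"

lemma factor_simps [simp]:
  "verts (factor i) = V" "arcs (factor i) = (\<lambda>x. (x, move i x)) ` V"
  "tail (factor i) = fst" "head (factor i) = snd"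
  by (simp_all add: factor_def)

lemma out_arcs_factor: "x \<in> V \<Longrightarrow> out_arcs (factor i) x = {(x, move i x)}"
  by (auto simp: out_arcs_def)

lemma next_vertex_factor: "x \<in> V \<Longrightarrow> next_vertex (factor i) x = move i x"
  by (simp add: next_vertex_def out_arcs_factor)

lemma in_degree_factor:
  assumes "x \<in> V" "i \<le> d" shows "in_degree (factor i) x = 1"
proof -
  have "x \<in> move i ` V" using bij_betw_move[OF assms(2)] assms(1) by (simp add: bij_betw_def)
  then obtain y where y: "y \<in> V" "move i y = x" by blast
  have "in_arcs (factor i) x = {(y, x)}"
    using y inj_on_move[OF assms(2)] by (auto simp: in_arcs_def inj_on_def)
  then show ?thesis by (simp add: in_degree_def)
qed

abbreviation "G \<equiv> with_proj (CP_graph d D)"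

lemma verts_G: "pverts (CP_graph d D) = V" by (simp add: CP_graph_def)

lemma wf_G: "wf_digraph G"
proof -
  interpret pair_wf_digraph "CP_graph d D" using D_pos by (rule pair_wf_digraph_CP_graph)
  show ?thesis by unfold_locales
qed

lemma one_factor_factor: "i \<in> {1..d} \<Longrightarrow> one_factor (factor i) G"
  unfolding one_factor_def spanning_def subgraph_def
  using in_degree_factor[of _ i] move_in_V[of _ i]
  by (auto simp: verts_G parcs_CP_graph wf_G out_degree_def out_arcs_factor compatible_def
      intro!: wf_digraph.intro)

lemma disjoint_factors:
  assumes "i \<in> {1..d}" "j \<in> {1..d}" "i \<noteq> j"
  shows "arcs (factor i) \<inter> arcs (factor j) = {}"
proof -
  have False if "x \<in> V" "move i x = move j x" for x
    using that assms move_symbol_eq_iff[of x i j] hd_touch[of x] CP_vertsD(4)[of x]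
    by (metis atLeastAtMost_iff move_def)
  then show ?thesis by auto
qed

lemma regular_G: "regular_digraph G d"
  unfolding regular_digraph_def
proof (intro ballI conjI)
  fix x assume "x \<in> verts G"
  then have x: "x \<in> V" by (simp add: verts_G)
  have disj: "in_arcs (factor i) x \<inter> in_arcs (factor j) x = {}"
      "out_arcs (factor i) x \<inter> out_arcs (factor j) x = {}" if "i \<in> {1..d}" "j \<in> {1..d}" "i \<noteq> j" for i j
    using disjoint_factors[OF that] unfolding in_arcs_def out_arcs_def by blast+
  have fin: "finite (in_arcs (factor i) x)" "finite (out_arcs (factor i) x)" for i
    unfolding in_arcs_def out_arcs_def using finite_V by simp_all
  have "in_arcs G x = (\<Union>i\<in>{1..d}. in_arcs (factor i) x)"
    by (auto simp: in_arcs_def parcs_CP_graph)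
  also have "card \<dots> = (\<Sum>i\<in>{1..d}. card (in_arcs (factor i) x))"
    by (rule card_UN_disjoint) (use disj fin in simp_all)
  also have "\<dots> = d" using in_degree_factor[OF x] by (simp add: in_degree_def)
  finally show "in_degree G x = d" by (simp add: in_degree_def)
  have "out_arcs G x = (\<Union>i\<in>{1..d}. out_arcs (factor i) x)"
    by (auto simp: out_arcs_def parcs_CP_graph)
  also have "card \<dots> = (\<Sum>i\<in>{1..d}. card (out_arcs (factor i) x))"
    by (rule card_UN_disjoint) (use disj fin in simp_all)
  also have "\<dots> = d" using x by (simp add: out_arcs_factor)
  finally show "out_degree G x = d" by (simp add: out_degree_def)
qed

lemma one_factoring_G: "one_factoring G d factor"
proof -
  have "(\<Union>i\<in>{1..d}. arcs (factor i)) = arcs G" by (auto simp: parcs_CP_graph)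
  then show ?thesis
    unfolding one_factoring_def using regular_G one_factor_factor disjoint_factors by blast
qed

end

section \<open>Words that label geodesics\<close>

text \<open>Suppose that \<open>i\<close> distinct symbols have been touched, which thus occupy the positions below \<open>i\<close>, and
  that \<open>c\<close> untouched symbols come right behind them. The value is how many of these remain untouched
  after the word, as long as each of its labels touches a new symbol: the window of the remaining
  ones moves back by one at each step and shrinks when a label falls into it. The count takes no account
  of symbols that drop off the end of the list.\<close>

fun pending :: "nat \<Rightarrow> nat \<Rightarrow> nat list \<Rightarrow> nat" where
  "pending i c [] = c"
| "pending i c (q # \<omega>) = pending (Suc i) (if q < i + c then c - 1 else c) \<omega>"

text \<open>As \<open>i\<close> touched symbols fill the first \<open>i\<close> positions, this says that every label touches a
  symbol not touched before.\<close>

fun fresh :: "nat \<Rightarrow> nat list \<Rightarrow> bool" where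
  "fresh i [] \<longleftrightarrow> True"
| "fresh i (q # \<omega>) \<longleftrightarrow> i \<le> q \<and> fresh (Suc i) \<omega>"

lemma pending_ge: "c \<le> pending i c \<omega> + length \<omega>"
proof (induction \<omega> arbitrary: i c)
  case (Cons q \<omega>)
  show ?case using Cons[of c "Suc i"] Cons[of "c - 1" "Suc i"] by auto
qed simp

context cp_graph
begin

primrec symbols :: "nat list \<Rightarrow> nat list \<Rightarrow> nat list" where
  "symbols x [] = []"
| "symbols x (i # \<omega>) = move_symbol i x # symbols (move i x) \<omega>"

lemma length_symbols [simp]: "length (symbols x \<omega>) = length \<omega>"
  by (induction \<omega> arbitrary: x) auto

lemma word_end_factor:
  "x \<in> V \<Longrightarrow> set \<omega> \<subseteq> {..d} \<Longrightarrow> word_end factor x \<omega> = fold touch (symbols x \<omega>) x"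
  by (induction \<omega> arbitrary: x) (auto simp: next_vertex_factor move_in_V move_def[symmetric])

lemma word_end_in_V: "x \<in> V \<Longrightarrow> set \<omega> \<subseteq> {..d} \<Longrightarrow> word_end factor x \<omega> \<in> V"
  by (induction \<omega> arbitrary: x) (auto simp: next_vertex_factor move_in_V)

lemma symbols_inj:
  "x \<in> V \<Longrightarrow> set \<omega> \<subseteq> {..d} \<Longrightarrow> set \<omega>' \<subseteq> {..d} \<Longrightarrow> symbols x \<omega> = symbols x \<omega>' \<Longrightarrow> \<omega> = \<omega>'"
proof (induction \<omega> arbitrary: x \<omega>')
  case Nil then show ?case by (cases \<omega>') auto
next
  case (Cons i \<omega>)
  then obtain j \<omega>'' where w: "\<omega>' = j # \<omega>''" by (cases \<omega>') auto
  have "i = j" using Cons.prems w move_symbol_eq_iff[of x i j] by simp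
  then show ?case using Cons.IH[of "move i x" \<omega>''] Cons.prems w move_in_V[of x i] by simp
qed

lemma symbols_surj:
  assumes "x \<in> V" "set ss \<subseteq> {1..d + 1}"
  obtains \<omega> where "set \<omega> \<subseteq> {..d}" "symbols x \<omega> = ss"
  using assms
proof (induction ss arbitrary: x thesis)
  case Nil
  show ?case by (rule Nil(1)[of "[]"]) simp_all
next
  case (Cons s ss)
  have "s \<in> (\<lambda>i. move_symbol i x) ` {..d}" using Cons.prems move_symbol_image[of x] by simp
  then obtain i where i: "i \<le> d" "s = move_symbol i x" by auto
  obtain \<omega> where "set \<omega> \<subseteq> {..d}" "symbols (move i x) \<omega> = ss"
    using Cons.IH[of "move i x"] Cons.prems move_in_V[of x i] i by auto
  then show ?case using i by (intro Cons.prems(1)[of "i # \<omega>"]) auto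
qed

lemma fold_touch_in_V:
  assumes "x \<in> V" "set us \<subseteq> {1..d + 1}" shows "fold touch us x \<in> V"
proof -
  obtain \<omega> where "set \<omega> \<subseteq> {..d}" "symbols x \<omega> = us" using symbols_surj assms by blast
  then show ?thesis using word_end_factor[of x \<omega>] word_end_in_V[of x \<omega>] assms by simp
qed

lemma fold_touch_distinct:
  assumes "x \<in> V" "distinct us" "length us \<le> D"
  shows "fold touch us x = rev us @ take (D - length us) (filter (\<lambda>a. a \<notin> set us) x)"
  using assms CP_vertsD by (simp add: fold_touch distinct_remdups_id)

text \<open>The touched symbols fill the first places, and distinct labels touch distinct symbols.\<close>

lemma touched_iff:
  assumes x: "x \<in> V" and us: "distinct us" "set us \<subseteq> {1..d + 1}" "length us \<le> D" and q: "q \<le> d"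
  shows "move_symbol q (fold touch us x) \<in> set us \<longleftrightarrow> q < length us"
proof -
  let ?y = "fold touch us x"
  have y: "?y \<in> V" using x us(2) by (rule fold_touch_in_V)
  have nth: "move_symbol j ?y = rev us ! j" if "j < length us" for j
    using that us fold_touch_distinct[OF x us(1,3)] by (simp add: move_symbol_less nth_append)
  show ?thesis
  proof
    assume "q < length us"
    then show "move_symbol q ?y \<in> set us" using nth[of q] nth_mem[of q "rev us"] by simp
  next
    assume "move_symbol q ?y \<in> set us"
    then obtain j where "j < length us" "move_symbol q ?y = rev us ! j"
      by (metis in_set_conv_nth length_rev set_rev)
    then show "q < length us" using nth[of j] move_symbol_eq_iff[OF y q, of j] us D_le by simp
  qed
qed

lemma fresh_iff_distinct:
  assumes "x \<in> V" "distinct us" "set us \<subseteq> {1..d + 1}" "length us + length \<omega> \<le> D" "set \<omega> \<subseteq> {..d}"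
  shows "fresh (length us) \<omega> \<longleftrightarrow> distinct (us @ symbols (fold touch us x) \<omega>)"
  using assms(2-)
proof (induction \<omega> arbitrary: us)
  case Nil then show ?case by simp
next
  case (Cons q \<omega>)
  let ?y = "fold touch us x" and ?us = "us @ [move_symbol q (fold touch us x)]"
  have y: "?y \<in> V" using assms(1) Cons.prems by (intro fold_touch_in_V)
  have s: "move_symbol q ?y \<notin> set us \<longleftrightarrow> length us \<le> q"
    using touched_iff[OF assms(1), of us q] Cons.prems by auto
  show ?case
  proof (cases "length us \<le> q")
    case True
    have "fresh (length ?us) \<omega> \<longleftrightarrow> distinct (?us @ symbols (fold touch ?us x) \<omega>)"
      using s True Cons.prems move_symbol_range[OF y, of q] by (intro Cons.IH) auto
    then show ?thesis using True by (simp add: move_def)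
  next
    case False
    then show ?thesis using s by auto
  qed
qed

text \<open>This is where the dependence on the vertex disappears. As long as the window of untouched symbols
  of \<open>P\<close> fits into the list, the positions in it are precisely the labels that touch symbols of \<open>P\<close>.
  Once it does not fit, its symbols may drop off and come back under a label of an edge \<open>S\<^sub>m\<close>, which
  the counter misses; but then more than \<open>D - i\<close> symbols of \<open>P\<close> are untouched after \<open>i\<close> steps, and
  the at most \<open>D - i\<close> remaining steps cannot touch them all, so that both sides are false.\<close>

lemma pending_eq_0_iff:
  assumes x: "x \<in> V" and P: "P = takeWhile (\<lambda>a. a \<noteq> s) x"
    and "distinct us" "set us \<subseteq> {1..d + 1}" "length us + length \<omega> \<le> D" "set \<omega> \<subseteq> {..d}"
    "fresh (length us) \<omega>"
  shows "pending (length us) (length (filter (\<lambda>a. a \<notin> set us) P)) \<omega> = 0 \<longleftrightarrow>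
     set P \<subseteq> set us \<union> set (symbols (fold touch us x) \<omega>)"
  using assms(3-)
proof (induction \<omega> arbitrary: us)
  case Nil
  then show ?case by (auto simp: filter_empty_conv)
next
  case (Cons q \<omega>)
  let ?y = "fold touch us x"
  let ?s = "move_symbol q ?y"
  let ?us = "us @ [?s]"
  let ?f = "\<lambda>us. filter (\<lambda>a. a \<notin> set us) P"
  let ?c = "length (?f us)" and ?i = "length us"
  have y: "?y \<in> V" using x Cons.prems by (intro fold_touch_in_V)
  have q: "q \<le> d" "?i \<le> q" using Cons.prems by auto
  have s: "?s \<notin> set us" using touched_iff[OF x, of us q] Cons.prems by auto
  have dP: "distinct P" using CP_vertsD[OF x] by (simp add: P)
  show ?case
  proof (cases "?i + ?c \<le> D")
    case True
    obtain r where r: "x = P @ r" using P by (metis takeWhile_dropWhile_id)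
    have y_eq: "?y = rev us @ ?f us @ take (D - ?i - ?c) (filter (\<lambda>a. a \<notin> set us) r)"
      using fold_touch_distinct[OF x, of us] Cons.prems True by (simp add: r)
    have nth: "move_symbol j ?y = ?f us ! (j - ?i)" if "?i \<le> j" "j < ?i + ?c" for j
    proof -
      have "j < D" "j - ?i < ?c" using that True by linarith+
      then show ?thesis using that by (simp add: move_symbol_less y_eq nth_append)
    qed
    have iff: "?s \<in> set P \<longleftrightarrow> q < ?i + ?c"
    proof
      assume "q < ?i + ?c"
      then have "?s \<in> set (?f us)" using nth[of q] q nth_mem[of "q - ?i" "?f us"] by simp
      then show "?s \<in> set P" by simp
    next
      assume "?s \<in> set P"
      then have "?s \<in> set (?f us)" using s by simp
      then obtain k where k: "k < ?c" "?s = ?f us ! k" by (metis in_set_conv_nth)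
      then have "?s = move_symbol (?i + k) ?y" using nth[of "?i + k"] by simp
      then show "q < ?i + ?c"
        using k move_symbol_eq_iff[OF y q(1), of "?i + k"] True D_le by simp
    qed
    have len: "length (?f ?us) = (if q < ?i + ?c then ?c - 1 else ?c)"
    proof -
      have "?f ?us = removeAll ?s (?f us)" by (auto simp: removeAll_filter_not_eq intro!: filter_cong)
      moreover have "distinct (?f us)" using dP by simp
      moreover have "?s \<in> set (?f us) \<longleftrightarrow> q < ?i + ?c" using iff s by simp
      ultimately show ?thesis by (simp add: distinct_remove1_removeAll[symmetric] length_remove1)
    qed
    have "pending (length ?us) (length (?f ?us)) \<omega> = 0 \<longleftrightarrow>
        set P \<subseteq> set ?us \<union> set (symbols (fold touch ?us x) \<omega>)"
      using Cons.prems s move_symbol_range[OF y q(1)] by (intro Cons.IH) auto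
    then show ?thesis unfolding len by (simp add: move_def)
  next
    case False
    then have c: "length (q # \<omega>) < ?c" using Cons.prems by simp
    then have "pending ?i ?c (q # \<omega>) \<noteq> 0" using pending_ge[of ?c ?i "q # \<omega>"] by linarith
    moreover have "\<not> set P \<subseteq> set us \<union> set (symbols ?y (q # \<omega>))"
    proof
      assume "set P \<subseteq> set us \<union> set (symbols ?y (q # \<omega>))"
      then have "set (?f us) \<subseteq> set (symbols ?y (q # \<omega>))" by auto
      then have "card (set (?f us)) \<le> card (set (symbols ?y (q # \<omega>)))" by (intro card_mono) auto
      also have "\<dots> \<le> length (q # \<omega>)" using card_length length_symbols by metis
      also have "card (set (?f us)) = ?c" using dP by (intro distinct_card) simp
      finally show False using c by simp
    qed
    ultimately show ?thesis by simp
  qed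
qed

text \<open>In the condition on the first label \<open>p\<close>, the number \<open>min p D\<close> counts the symbols in front of the
  one that it touches. These are all \<open>D\<close> symbols if the touched symbol is new. Label 0 cannot occur:
  it would leave nothing pending.\<close>

definition geodesic_words :: "nat list set" where
  "geodesic_words = {\<omega>. length \<omega> \<le> D \<and> set \<omega> \<subseteq> {..d} \<and> fresh 0 \<omega> \<and>
     (\<forall>p \<omega>'. \<omega> = p # \<omega>' \<longrightarrow> pending 1 (min p D) \<omega>' \<noteq> 0)}"

lemma takeWhile_move_symbol:
  assumes "x \<in> V" "p \<le> d"
  shows "takeWhile (\<lambda>a. a \<noteq> move_symbol p x) x = take (min p D) x"
proof (cases "p < D")
  case True
  have "move_symbol p x \<notin> set (take p x)"
    using True CP_vertsD[OF assms(1)]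
    by (auto simp: move_symbol_less in_set_conv_nth nth_eq_iff_index_eq)
  moreover have "x = take p x @ move_symbol p x # drop (Suc p) x"
    using True CP_vertsD(1)[OF assms(1)] by (simp add: move_symbol_less id_take_nth_drop[symmetric])
  moreover have "takeWhile (\<lambda>a. a \<noteq> s) (l @ s # r) = l" if "s \<notin> set l" for s :: nat and l r
    using that by (subst takeWhile_append2) auto
  ultimately have "takeWhile (\<lambda>a. a \<noteq> move_symbol p x) x = take p x" by metis
  then show ?thesis using True by simp
next
  case False
  then show ?thesis using move_symbol_notin[of x p] assms CP_vertsD(1)[OF assms(1)]
    by (auto simp: takeWhile_eq_all_conv)
qed

lemma geodesic_words_iff:
  assumes x: "x \<in> V" and \<omega>: "length \<omega> \<le> D" "set \<omega> \<subseteq> {..d}"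
  shows "\<omega> \<in> geodesic_words \<longleftrightarrow> geodesic_symbols x (symbols x \<omega>)"
proof (cases \<omega>)
  case Nil
  then show ?thesis by (simp add: geodesic_words_def geodesic_symbols_def)
next
  case (Cons p \<omega>')
  let ?s = "move_symbol p x"
  let ?P = "takeWhile (\<lambda>a. a \<noteq> ?s) x" and ?ts = "symbols (move p x) \<omega>'"
  have p: "p \<le> d" using \<omega> Cons by simp
  have fresh: "fresh 0 \<omega> \<longleftrightarrow> distinct (?s # ?ts)"
    using fresh_iff_distinct[OF x, of "[]" \<omega>] \<omega> Cons by simp
  have s: "?s \<notin> set ?P" using set_takeWhileD by fastforce
  then have "filter (\<lambda>a. a \<notin> set [?s]) ?P = ?P" by (auto simp: filter_id_conv)
  moreover have "length ?P = min p D"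
    using takeWhile_move_symbol[OF x p] CP_vertsD(1)[OF x] by simp
  ultimately have "pending 1 (min p D) \<omega>' = 0 \<longleftrightarrow> set ?P \<subseteq> set ?ts" if "fresh 0 \<omega>"
    using pending_eq_0_iff[OF x refl, of "[?s]" \<omega>' ?s] that \<omega> Cons s move_symbol_range[OF x p]
    by (auto simp: move_def)
  then show ?thesis
    using \<omega> fresh by (auto simp: geodesic_words_def geodesic_symbols_def Cons)
qed

lemma geodesic_words_labels: "\<omega> \<in> geodesic_words \<Longrightarrow> set \<omega> \<subseteq> {1..d}"
proof -
  have *: "fresh i \<omega> \<Longrightarrow> j \<in> set \<omega> \<Longrightarrow> i \<le> j" for i j \<omega>
    by (induction i \<omega> rule: fresh.induct) auto
  have zero: "pending i 0 \<omega> = 0" for i \<omega> by (induction \<omega> arbitrary: i) auto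
  assume w: "\<omega> \<in> geodesic_words"
  show "set \<omega> \<subseteq> {1..d}"
  proof (cases \<omega>)
    case (Cons p \<omega>')
    then have "p \<noteq> 0" "fresh 1 \<omega>'" "set \<omega> \<subseteq> {..d}"
      using w by (auto simp: geodesic_words_def zero intro!: gr0I)
    then show ?thesis using Cons *[of 1 \<omega>'] by auto
  qed simp
qed

text \<open>From each vertex, words and symbol sequences determine each other, so this is uniqueness and
  existence of geodesic symbol sequences.\<close>

lemma bij_betw_geodesic_words:
  assumes x: "x \<in> V"
  shows "bij_betw (word_end factor x) geodesic_words V"
proof (rule bij_betw_imageI)
  have *: "length \<omega> \<le> D" "set \<omega> \<subseteq> {..d}" "geodesic_symbols x (symbols x \<omega>)"
    "word_end factor x \<omega> = fold touch (symbols x \<omega>) x" if "\<omega> \<in> geodesic_words" for \<omega>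
  proof -
    show len: "length \<omega> \<le> D" and sub: "set \<omega> \<subseteq> {..d}"
      using that unfolding geodesic_words_def by blast+
    show "geodesic_symbols x (symbols x \<omega>)" using that by (simp only: geodesic_words_iff[OF x len sub])
    show "word_end factor x \<omega> = fold touch (symbols x \<omega>) x" by (rule word_end_factor[OF x sub])
  qed
  show "inj_on (word_end factor x) geodesic_words"
  proof (rule inj_onI)
    fix \<omega> \<omega>' assume w: "\<omega> \<in> geodesic_words" "\<omega>' \<in> geodesic_words"
      and eq: "word_end factor x \<omega> = word_end factor x \<omega>'"
    have len: "length (symbols x \<omega>) \<le> length x" "length (symbols x \<omega>') \<le> length x"
      using *(1)[OF w(1)] *(1)[OF w(2)] CP_vertsD(1)[OF x] by simp_all
    have "fold touch (symbols x \<omega>) x = fold touch (symbols x \<omega>') x"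
      using eq by (simp only: *(4)[OF w(1)] *(4)[OF w(2)])
    then have "symbols x \<omega> = symbols x \<omega>'"
      by (rule geodesic_symbols_unique[OF CP_vertsD(2)[OF x] *(3)[OF w(1)] len(1) *(3)[OF w(2)] len(2)])
    then show "\<omega> = \<omega>'" by (rule symbols_inj[OF x *(2)[OF w(1)] *(2)[OF w(2)]])
  qed
  show "word_end factor x ` geodesic_words = V"
  proof (intro equalityI subsetI)
    fix w assume "w \<in> word_end factor x ` geodesic_words"
    then show "w \<in> V" using *(2) word_end_in_V[OF x] by blast
  next
    fix w assume w: "w \<in> V"
    have "length w = length x" using CP_vertsD(1)[OF x] CP_vertsD(1)[OF w] by simp
    with CP_vertsD(2)[OF x] CP_vertsD(2)[OF w] obtain ss where ss: "geodesic_symbols x ss"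
      "length ss \<le> length x" "set ss \<subseteq> set w" "fold touch ss x = w"
      by (rule geodesic_symbols_exist)
    obtain \<omega> where \<omega>: "set \<omega> \<subseteq> {..d}" "symbols x \<omega> = ss"
      using symbols_surj[OF x, of ss] ss(3) CP_vertsD(3)[OF w] by blast
    have "length \<omega> \<le> D" using length_symbols[of x \<omega>] \<omega> ss CP_vertsD(1)[OF x] by simp
    then have "\<omega> \<in> geodesic_words" using geodesic_words_iff[OF x] \<omega> ss by simp
    moreover have "word_end factor x \<omega> = w" using word_end_factor[OF x \<omega>(1)] \<omega> ss by simp
    ultimately show "w \<in> word_end factor x ` geodesic_words" by blast
  qed
qed

end

section \<open>Distances and shortness\<close>

context cp_graph
begin

lemma word_walk:
  assumes "x \<in> V" "set \<omega> \<subseteq> {1..d}"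
  shows "\<exists>p. pre_digraph.awalk G x p (word_end factor x \<omega>) \<and> length p = length \<omega>"
  using assms
proof (induction \<omega> arbitrary: x)
  case Nil
  then show ?case by (simp add: pre_digraph.awalk_def pre_digraph.cas.simps verts_G)
next
  case (Cons i \<omega>)
  have i: "i \<in> {1..d}" and y: "move i x \<in> V" using Cons.prems move_in_V[of x i] by auto
  obtain p where p: "pre_digraph.awalk G (move i x) p (word_end factor (move i x) \<omega>)"
    "length p = length \<omega>"
    using Cons.IH[OF y] Cons.prems by auto
  have "(x, move i x) \<in> arcs G" using Cons.prems(1) i by (auto simp: parcs_CP_graph)
  then have "pre_digraph.awalk G x ((x, move i x) # p) (word_end factor (move i x) \<omega>)"
    using p(1) Cons.prems(1) by (simp add: pre_digraph.awalk_def pre_digraph.cas.simps verts_G)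
  then show ?case using p(2) Cons.prems(1) next_vertex_factor[of x i]
    by (intro exI[of _ "(x, move i x) # p"]) simp
qed

lemma walk_touches:
  "pre_digraph.cas G x p w \<Longrightarrow> set p \<subseteq> arcs G \<Longrightarrow> \<exists>ts. length ts = length p \<and> fold touch ts x = w"
proof (induction p arbitrary: x)
  case Nil
  then show ?case by (simp add: pre_digraph.cas.simps)
next
  case (Cons e p)
  then obtain i where e: "e = (x, move i x)" by (auto simp: pre_digraph.cas.simps parcs_CP_graph)
  have "pre_digraph.cas G (move i x) p w" using Cons.prems(1) e by (simp add: pre_digraph.cas.simps)
  then obtain ts where "length ts = length p" "fold touch ts (move i x) = w"
    using Cons.IH Cons.prems(2) by auto
  then show ?case by (intro exI[of _ "move_symbol i x # ts"]) (simp add: move_def)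
qed

text \<open>Every walk, geodesic or not, is a sequence of touches, so the minimality of geodesic symbol sequences
  bounds its length.\<close>

lemma distance_word_end:
  assumes x: "x \<in> V" and \<omega>: "\<omega> \<in> geodesic_words"
  shows "distance G x (word_end factor x \<omega>) = ereal (real (length \<omega>))"
proof -
  have len: "length \<omega> \<le> D" and sub: "set \<omega> \<subseteq> {..d}"
    using \<omega> unfolding geodesic_words_def by blast+
  have geo: "geodesic_symbols x (symbols x \<omega>)"
    using \<omega> by (simp only: geodesic_words_iff[OF x len sub])
  have "length \<omega> \<le> length p" if p: "pre_digraph.awalk G x p (word_end factor x \<omega>)" for p
  proof -
    obtain ts where ts: "length ts = length p" "fold touch ts x = word_end factor x \<omega>"
      using walk_touches p unfolding pre_digraph.awalk_def by blast
    have eq: "fold touch (symbols x \<omega>) x = fold touch ts x"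
      unfolding ts(2) by (rule word_end_factor[OF x sub, symmetric])
    have le: "length (symbols x \<omega>) \<le> length x" using len CP_vertsD(1)[OF x] by simp
    have "length (symbols x \<omega>) \<le> length ts"
      by (rule geodesic_symbols_minimal[OF CP_vertsD(2)[OF x] geo le eq])
    then show ?thesis using ts(1) by simp
  qed
  moreover have "\<exists>p. pre_digraph.awalk G x p (word_end factor x \<omega>) \<and> length p = length \<omega>"
    by (rule word_walk[OF x geodesic_words_labels[OF \<omega>]])
  ultimately show ?thesis
    unfolding wf_digraph.distance_eq_iff[OF wf_G] by blast
qed

lemma V_nonempty: "V \<noteq> {}"
proof -
  have "[1..<Suc D] \<in> V" using D_le by (auto simp: CP_verts_def)
  then show ?thesis by blast
qed

lemma finite_geodesic_words: "finite geodesic_words"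
  and card_geodesic_words: "card geodesic_words = card V"
proof -
  obtain x where "x \<in> V" using V_nonempty by blast
  then have bij: "bij_betw (word_end factor x) geodesic_words V" by (rule bij_betw_geodesic_words)
  show "finite geodesic_words" using bij_betw_finite[OF bij] finite_V by simp
  show "card geodesic_words = card V" using bij by (rule bij_betw_same_card)
qed

lemma vertex_eq_word_end:
  assumes "x \<in> V" "w \<in> V" obtains \<omega> where "\<omega> \<in> geodesic_words" "w = word_end factor x \<omega>"
  using bij_betw_imp_surj_on[OF bij_betw_geodesic_words[OF assms(1)]] assms(2) by blast

lemma diameter_le: "diameter G \<le> ereal (real D)"
  unfolding diameter_def
proof (intro SUP_least)
  fix x w assume "x \<in> verts G" "w \<in> verts G"
  then have x: "x \<in> V" and w: "w \<in> V" by (simp_all add: verts_G)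
  obtain \<omega> where \<omega>: "\<omega> \<in> geodesic_words" "w = word_end factor x \<omega>"
    using vertex_eq_word_end[OF x w] .
  have "length \<omega> \<le> D" using \<omega>(1) unfolding geodesic_words_def by blast
  then show "distance G x w \<le> ereal (real D)"
    by (simp add: \<omega>(2) distance_word_end[OF x \<omega>(1)])
qed

lemma length_le_diameter:
  assumes "\<omega> \<in> geodesic_words" shows "ereal (real (length \<omega>)) \<le> diameter G"
proof -
  obtain x where x: "x \<in> V" using V_nonempty by blast
  have w: "word_end factor x \<omega> \<in> V"
    using bij_betw_apply[OF bij_betw_geodesic_words[OF x] assms] .
  have "distance G x (word_end factor x \<omega>) \<le> (SUP w\<in>verts G. distance G x w)"
    by (rule SUP_upper) (simp add: verts_G w)
  also have "\<dots> \<le> diameter G"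
    unfolding diameter_def by (rule SUP_upper) (simp add: verts_G x)
  finally have "distance G x (word_end factor x \<omega>) \<le> diameter G" .
  then show ?thesis by (simp only: distance_word_end[OF x assms])
qed

lemma num_pairs_at_distance_G:
  "num_pairs_at_distance G k = card V * card {\<omega> \<in> geodesic_words. length \<omega> = k}"
proof -
  let ?L = "{\<omega> \<in> geodesic_words. length \<omega> = k}"
  let ?g = "\<lambda>(x, \<omega>). (x, word_end factor x \<omega>)"
  have "{(u, w). u \<in> verts G \<and> w \<in> verts G \<and> distance G u w = ereal (real k)} = ?g ` (V \<times> ?L)" (is "?A = _")
  proof (intro equalityI subsetI)
    fix e assume "e \<in> ?A"
    then obtain x w where e: "e = (x, w)" and x: "x \<in> V" and w: "w \<in> V"
      and d: "distance G x w = ereal (real k)" by (auto simp: verts_G)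
    obtain \<omega> where \<omega>: "\<omega> \<in> geodesic_words" "w = word_end factor x \<omega>"
      using vertex_eq_word_end[OF x w] .
    have "length \<omega> = k" using d distance_word_end[OF x \<omega>(1)] \<omega>(2) by simp
    then show "e \<in> ?g ` (V \<times> ?L)" using e x \<omega> by auto
  next
    fix e assume "e \<in> ?g ` (V \<times> ?L)"
    then obtain x \<omega> where e: "e = (x, word_end factor x \<omega>)" and x: "x \<in> V"
      and \<omega>: "\<omega> \<in> geodesic_words" "length \<omega> = k" by auto
    have "word_end factor x \<omega> \<in> V"
      using bij_betw_apply[OF bij_betw_geodesic_words[OF x] \<omega>(1)] .
    then show "e \<in> ?A" using e x distance_word_end[OF x \<omega>(1)] \<omega>(2) by (simp add: verts_G)
  qed
  moreover have "inj_on ?g (V \<times> ?L)"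
  proof (rule inj_onI)
    fix a b assume "a \<in> V \<times> ?L" "b \<in> V \<times> ?L" "?g a = ?g b"
    moreover obtain x \<omega> y \<upsilon> where "a = (x, \<omega>)" "b = (y, \<upsilon>)" by fastforce
    ultimately show "a = b"
      using inj_onD[OF bij_betw_imp_inj_on[OF bij_betw_geodesic_words[of x]], of \<omega> \<upsilon>] by auto
  qed
  ultimately show ?thesis
    unfolding num_pairs_at_distance_def by (simp add: card_image card_cartesian_product)
qed

text \<open>From every vertex, exactly as many vertices lie at distance \<open>k\<close> as there are words of length \<open>k\<close>
  in the list. Lengths beyond the diameter do not occur, so restricting the sum loses nothing.\<close>

lemma sum_distances:
  "(\<Sum>k | 1 \<le> k \<and> ereal (real k) \<le> diameter G.
      real (k * num_pairs_at_distance G k) / real (card (verts G) * d)) =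
   real (\<Sum>\<omega>\<in>geodesic_words. length \<omega>) / real d"
proof -
  let ?I = "{k. 1 \<le> k \<and> ereal (real k) \<le> diameter G}"
  let ?N = "\<lambda>k. card {\<omega> \<in> geodesic_words. length \<omega> = k}"
  have "?I \<subseteq> {..D}"
  proof
    fix k assume "k \<in> ?I"
    then have "ereal (real k) \<le> ereal (real D)" using diameter_le order_trans by blast
    then show "k \<in> {..D}" by simp
  qed
  moreover have "k * ?N k = 0" if "k \<in> {..D} - ?I" for k
  proof (cases "k = 0")
    case False
    then have "\<not> ereal (real k) \<le> diameter G" using that by auto
    then have "{\<omega> \<in> geodesic_words. length \<omega> = k} = {}" using length_le_diameter by blast
    then show ?thesis by (simp only: card.empty mult_0_right)
  qed simp
  ultimately have "(\<Sum>k\<in>?I. k * ?N k) = (\<Sum>k\<in>{..D}. k * ?N k)"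
    by (intro sum.mono_neutral_left) auto
  also have "\<dots> = (\<Sum>k\<in>{..D}. \<Sum>\<omega>\<in>{\<omega> \<in> geodesic_words. length \<omega> = k}. length \<omega>)"
    by (intro sum.cong refl) simp
  also have "\<dots> = (\<Sum>\<omega>\<in>geodesic_words. length \<omega>)"
    by (rule sum.group[OF finite_geodesic_words]) (auto simp: geodesic_words_def)
  finally have *: "(\<Sum>k\<in>?I. k * ?N k) = (\<Sum>\<omega>\<in>geodesic_words. length \<omega>)" .
  have n: "card V > 0" using V_nonempty finite_V by (simp add: card_gt_0_iff)
  have "(\<Sum>k\<in>?I. real (k * num_pairs_at_distance G k) / real (card (verts G) * d)) =
      (\<Sum>k\<in>?I. real (k * ?N k) / real d)"
    using n by (intro sum.cong refl) (simp add: num_pairs_at_distance_G verts_G)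
  also have "\<dots> = real (\<Sum>k\<in>?I. k * ?N k) / real d"
    by (simp add: sum_divide_distrib)
  finally show ?thesis unfolding * .
qed

lemma short_spanning_factorization_exists: "\<exists>W. short_spanning_factorization G d factor W"
proof -
  have empty: "[] \<in> geodesic_words" by (simp add: geodesic_words_def)
  obtain ws where ws: "set ws = geodesic_words - {[]}" "distinct ws"
    using finite_distinct_list[of "geodesic_words - {[]}"] finite_geodesic_words by blast
  define W where "W = [] # ws"
  have W: "set W = geodesic_words" "distinct W" "W ! 0 = []" using ws empty by (auto simp: W_def)
  have "length W = card V" using distinct_card[OF W(2)] W(1) card_geodesic_words by simp
  moreover have "distinct (map (word_end factor x) W)" if "x \<in> V" for x
    using bij_betw_imp_inj_on[OF bij_betw_geodesic_words[OF that]] W by (simp add: distinct_map)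
  ultimately have "spanning_factorization G d factor W"
    unfolding spanning_factorization_def
    using one_factoring_G W geodesic_words_labels by (auto simp: verts_G)
  moreover have "(\<Sum>i=1..d. occurrences W i) = (\<Sum>\<omega>\<in>geodesic_words. length \<omega>)"
  proof -
    have "(\<Sum>i=1..d. occurrences W i) = (\<Sum>i=1..d. \<Sum>\<omega>\<in>geodesic_words. count_list \<omega> i)"
      unfolding occurrences_def using W by (simp add: sum_list_distinct_conv_sum_set)
    also have "\<dots> = (\<Sum>\<omega>\<in>geodesic_words. \<Sum>i=1..d. count_list \<omega> i)" by (rule sum.swap)
    also have "\<dots> = (\<Sum>\<omega>\<in>geodesic_words. length \<omega>)"
      using geodesic_words_labels by (intro sum.cong refl sum_count_set) auto
    finally show ?thesis .
  qed
  then have "(\<Sum>i=1..d. real (occurrences W i)) / real d = real (\<Sum>\<omega>\<in>geodesic_words. length \<omega>) / real d"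
    by (metis of_nat_sum)
  ultimately have "short_spanning_factorization G d factor W"
    unfolding short_spanning_factorization_def sum_distances by (simp only: simp_thms)
  then show ?thesis by blast
qed

end

theorem theorem3:
  fixes d D :: nat
  assumes "1 \<le> D" and "D \<le> d"
  shows "\<exists>F W. short_spanning_factorization (with_proj (CP_graph d D)) d F W"
proof -
  interpret cp_graph d D using assms by unfold_locales
  show ?thesis using short_spanning_factorization_exists by blast
qed

end
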